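(* Let $k,l\in\mathbb{N}_0$, let $\mu\in\mathbb{C}$ be such that the coefficients below are defined (no vanishing denominators), and let $x\in\mathbb{R}$, $x\ne0$. Then $$C_k^{\mu+1/2}(x)=\sum_{m=0}^{[k/2]}\frac{\Lambda_1(k,m,\mu)}{x^{-m}}\,C_{k-2m}^{\frac12-2k+2m-\mu}(x)\,C_m^{k-m+\mu+\frac12}\!\left(\frac{1+x^2}{2x}\right),$$ $$x^{l}\,C_l^{\mu+l+1/2}\!\left(\frac{1+x^2}{2x}\right)=\sum_{n=0}^{2l}\Lambda_2(l,n,\mu)\,C_n^{\frac12+2l+\mu-n}(x)\,C_{2l-n}^{\mu+n+\frac12}(x),$$ where $$\Lambda_1(k,m,\mu)=\frac{(-1)^{k+m}2^{2m}(2k+2\mu)_{k-2m}\left(\mu+\frac12\right)_{k-m}}{\left(\frac12+\mu+k\right)_{k-2m}(2\mu+k+1)_{k-m}},$$ $$\Lambda_2(l,n,\mu)=\frac{(-1)^{n+l}(-4l-2\mu)_n\left(\mu+l+\frac12\right)_{n-l}}{2^{2l}\left(\frac12-2l-\mu\right)_n(2\mu+3l+1)_{n-l}}.$$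
   Context: $\mathbb{N}_0=\{0,1,2,\dots\}$; $(a)_j=\Gamma(a+j)/\Gamma(a)$ for integers $j$ of either sign, i.e. $(a)_j=a(a+1)\cdots(a+j-1)$ for $j\ge0$ and $(a)_{-j}=1/((a-1)(a-2)\cdots(a-j))$ for $j>0$; $[\cdot]$ is the integer part. $C_k^{\lambda}(x)=\sum_{j=0}^{[k/2]}\frac{(-1)^j(\lambda)_{k-j}}{j!\,(k-2j)!}(2x)^{k-2j}$ is the Gegenbauer polynomial, for any $\lambda\in\mathbb{C}$. *)

theory Defs
  imports Complex_Main
begin

definition gegenbauer :: "nat \<Rightarrow> complex \<Rightarrow> complex \<Rightarrow> complex" where
  "gegenbauer k a x =
     (\<Sum>j = 0..k div 2.
        (-1) ^ j * pochhammer a (k - j) / (fact j * fact (k - 2 * j)) * (2 * x) ^ (k - 2 * j))"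

text \<open>
  The symbol \<open>(a)\<^sub>j\<close> for integers \<open>j\<close> of either sign. For negative \<open>j\<close> it is
  meaningful only if \<open>poch_int_defined a j\<close> holds: otherwise the product in the denominator
  vanishes and the value \<open>0\<close> below is a mere artefact of division by zero.
\<close>

definition poch_int :: "complex \<Rightarrow> int \<Rightarrow> complex" where
  "poch_int a j =
     (if j \<ge> 0 then pochhammer a (nat j) else 1 / (\<Prod>i = 1..nat (- j). a - of_nat i))"

definition poch_int_defined :: "complex \<Rightarrow> int \<Rightarrow> bool" where
  "poch_int_defined a j \<longleftrightarrow> (j < 0 \<longrightarrow> (\<Prod>i = 1..nat (- j). a - of_nat i) \<noteq> 0)"

text \<open>
  In \<open>\<Lambda>\<^sub>1\<close> only indices with \<open>2 * m \<le> k\<close> are used, so the natural-number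
  differences do not truncate and all Pochhammer symbols have nonnegative index.
\<close>

definition Lambda1 :: "nat \<Rightarrow> nat \<Rightarrow> complex \<Rightarrow> complex" where
  "Lambda1 k m \<mu> =
     ((-1) ^ (k + m) * 2 ^ (2 * m)
        * pochhammer (2 * of_nat k + 2 * \<mu>) (k - 2 * m) * pochhammer (\<mu> + 1/2) (k - m))
     / (pochhammer (1/2 + \<mu> + of_nat k) (k - 2 * m)
        * pochhammer (2 * \<mu> + of_nat k + 1) (k - m))"

definition Lambda1_defined :: "nat \<Rightarrow> nat \<Rightarrow> complex \<Rightarrow> bool" where
  "Lambda1_defined k m \<mu> \<longleftrightarrow>
     pochhammer (1/2 + \<mu> + of_nat k) (k - 2 * m) \<noteq> 0 \<and>
     pochhammer (2 * \<mu> + of_nat k + 1) (k - m) \<noteq> 0"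

definition Lambda2 :: "nat \<Rightarrow> nat \<Rightarrow> complex \<Rightarrow> complex" where
  "Lambda2 l n \<mu> =
     ((-1) ^ (n + l) * pochhammer (- 4 * of_nat l - 2 * \<mu>) n
        * poch_int (\<mu> + of_nat l + 1/2) (int n - int l))
     / (2 ^ (2 * l) * pochhammer (1/2 - 2 * of_nat l - \<mu>) n
        * poch_int (2 * \<mu> + 3 * of_nat l + 1) (int n - int l))"

definition Lambda2_defined :: "nat \<Rightarrow> nat \<Rightarrow> complex \<Rightarrow> bool" where
  "Lambda2_defined l n \<mu> \<longleftrightarrow>
     poch_int_defined (\<mu> + of_nat l + 1/2) (int n - int l) \<and>
     poch_int_defined (2 * \<mu> + 3 * of_nat l + 1) (int n - int l) \<and>
     pochhammer (1/2 - 2 * of_nat l - \<mu>) n \<noteq> 0 \<and>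
     poch_int (2 * \<mu> + 3 * of_nat l + 1) (int n - int l) \<noteq> 0"

end

theory Submission
  imports Defs "HOL-Computational_Algebra.Formal_Power_Series"
begin

text \<open>
  Write \<open>T\<^sub>n\<^sup>b(s, w)\<close> for the coefficient of \<open>t\<^sup>n\<close> in \<open>(1 - s t + w t\<^sup>2)\<close> raised to the power \<open>-b\<close>,
  so that \<open>T\<^sub>n\<^sup>b(2x, 1)\<close> is the Gegenbauer polynomial of degree \<open>n\<close> and parameter \<open>b\<close>. Expanding the
  power in two ways, directly and after completing the square, gives two finite sums for
  \<open>T\<^sub>n\<^sup>b(s, w)\<close>. Comparing them coefficient by coefficient yields a reflection law
  (\<open>gegenbauer_hom_reflection\<close>): up to Pochhammer factors, \<open>T\<^sub>n\<^sup>b(s, w)\<close> equals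
  \<open>T\<^sub>n\<^sup>c(s, s\<^sup>2/4 - w)\<close> with \<open>c = 1/2 - b - n\<close>.

  On the right-hand sides of the two identities the parameters of the Gegenbauer polynomials depend on
  the summation index. The reflection law removes this dependence; it applies to the left-hand sides as
  well. The polynomials in \<open>x\<close> turn into
  \<open>T\<^sub>n\<^sup>b(2x, x\<^sup>2 - 1)\<close>, and those in \<open>(1 + x\<^sup>2)/(2x)\<close>, after multiplication by a power of \<open>x\<close>, turn into
  \<open>T\<^sub>n\<^sup>d(2(x\<^sup>2 + 1), (x\<^sup>2 - 1)\<^sup>2)\<close>, where \<open>b\<close> and \<open>d\<close> no longer depend on the index and
  \<open>d = -b\<close> in the first identity, \<open>d = b\<close> in the second. (On the left of the first identity
  the polynomial in \<open>x\<close> also gets the parameter \<open>d\<close>.) The Pochhammer symbols that the law introduces combine with \<open>\<Lambda>\<^sub>1\<close> and \<open>\<Lambda>\<^sub>2\<close> to factors that are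
  constant in the index, apart from a sign.

  What remains are convolutions, and these follow from one factorisation. For
  \<open>A(t) = 1 - 2xt + (x\<^sup>2 - 1)t\<^sup>2\<close> the product \<open>A(t) A(-t)\<close> is
  \<open>1 - 2(x\<^sup>2 + 1)t\<^sup>2 + (x\<^sup>2 - 1)\<^sup>2 t\<^sup>4\<close>. The first identity is the coefficient of \<open>t\<^sup>k\<close> in
  \<open>A(t)\<^sup>-\<^sup>b \<sqdot> (A(t) A(-t))\<^sup>b = A(-t)\<^sup>b\<close>, and the second is the coefficient of
  \<open>t\<close> to the power \<open>2l\<close> in \<open>A(-t)\<^sup>-\<^sup>b \<sqdot> A(t)\<^sup>-\<^sup>b = (A(t) A(-t))\<^sup>-\<^sup>b\<close>.

  The polynomial laws used hold for all parameters, and a division takes place only by quantities that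
  the hypotheses make nonzero; hence degenerate values of \<open>\<mu>\<close> need no limiting argument.
\<close>

unbundle fps_syntax

section \<open>Powers of formal power series with arbitrary exponent\<close>

text \<open>
  This is \<open>f\<close> to the power \<open>c\<close> by the binomial series; the composition is meaningful only for
  series with constant term \<open>1\<close>.
\<close>
definition fps_cpow :: "'a::field_char_0 fps \<Rightarrow> 'a \<Rightarrow> 'a fps" where
  "fps_cpow f c = fps_binomial c oo (f - 1)"

lemma fps_cpow_nth_0 [simp]: "fps_cpow f c $ 0 = 1"
  by (simp add: fps_cpow_def)

lemma fps_cpow_0 [simp]: "fps_cpow f 0 = 1"
  by (simp add: fps_cpow_def)

lemma fps_cpow_1: "f $ 0 = 1 \<Longrightarrow> fps_cpow f 1 = f"
  by (simp add: fps_cpow_def fps_binomial_1 fps_compose_add_distrib fps_X_fps_compose fps_eq_iff)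

lemma fps_cpow_add:
  assumes "f $ 0 = 1"
  shows "fps_cpow f (c + d) = fps_cpow f c * fps_cpow f d"
  using assms by (simp add: fps_cpow_def fps_binomial_add_mult fps_compose_mult_distrib)

lemma fps_cpow_power:
  assumes "f $ 0 = 1"
  shows "fps_cpow f c ^ n = fps_cpow f (of_nat n * c)"
  using assms by (induction n) (simp_all add: fps_cpow_add ring_distribs)

lemma fps_cpow_deriv:
  assumes "f $ 0 = 1"
  shows "f * fps_deriv (fps_cpow f c) = fps_const c * fps_deriv f * fps_cpow f c"
proof -
  have "fps_deriv (fps_binomial c) * (1 + fps_X) = fps_const c * fps_binomial c"
    by (simp add: fps_binomial_deriv fps_divide_unit mult.assoc inverse_mult_eq_1)
  then have "(fps_deriv (fps_binomial c) * (1 + fps_X)) oo (f - 1)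
      = (fps_const c * fps_binomial c) oo (f - 1)"
    by simp
  moreover have "(1 + fps_X) oo (f - 1) = f"
    using assms by (simp add: fps_compose_add_distrib fps_X_fps_compose fps_eq_iff)
  ultimately have "(fps_deriv (fps_binomial c) oo (f - 1)) * f = fps_const c * fps_cpow f c"
    using assms by (simp add: fps_compose_mult_distrib fps_cpow_def)
  moreover have "fps_deriv (fps_cpow f c) = (fps_deriv (fps_binomial c) oo (f - 1)) * fps_deriv f"
    using assms by (simp add: fps_cpow_def fps_compose_deriv)
  ultimately show ?thesis
    by (simp add: mult_ac)
qed

text \<open>
  The power \<open>f\<^sup>c\<close> is determined by the differential equation \<open>f g' = c f' g\<close>: multiplying a
  solution by the inverse power gives a series with derivative zero.
\<close>
lemma fps_cpow_unique:
  assumes f: "f $ 0 = 1" and g: "g $ 0 = 1"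
    and ode: "f * fps_deriv g = fps_const c * fps_deriv f * g"
  shows "g = fps_cpow f c"
proof -
  let ?h = "fps_cpow f (- c)"
  have "f * fps_deriv (g * ?h) = (f * fps_deriv g) * ?h + g * (f * fps_deriv ?h)"
    by (simp add: algebra_simps)
  also have "\<dots> = 0"
    unfolding ode fps_cpow_deriv[OF f] by (simp add: algebra_simps flip: fps_const_neg)
  finally have "fps_deriv (g * ?h) = 0"
    using f by auto
  then have "g * ?h = 1"
    using g by (simp only: fps_deriv_eq_0_iff) simp
  then have "g * (?h * fps_cpow f c) = fps_cpow f c"
    by (simp flip: mult.assoc)
  also have "?h * fps_cpow f c = 1"
    using fps_cpow_add[OF f, of "- c" c] by simp
  finally show ?thesis by simp
qed

text \<open>Both sides solve the differential equation that characterises the power of \<open>f g\<close>.\<close>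
lemma fps_cpow_mult:
  assumes f: "f $ 0 = 1" and g: "g $ 0 = 1"
  shows "fps_cpow (f * g) c = fps_cpow f c * fps_cpow g c"
proof (rule fps_cpow_unique[symmetric])
  have "f * g * fps_deriv (fps_cpow f c * fps_cpow g c)
      = g * fps_cpow g c * (f * fps_deriv (fps_cpow f c))
        + f * fps_cpow f c * (g * fps_deriv (fps_cpow g c))"
    by (simp add: algebra_simps)
  also have "\<dots> = fps_const c * fps_deriv (f * g) * (fps_cpow f c * fps_cpow g c)"
    unfolding fps_cpow_deriv[OF f] fps_cpow_deriv[OF g] by (simp add: algebra_simps)
  finally show "f * g * fps_deriv (fps_cpow f c * fps_cpow g c)
      = fps_const c * fps_deriv (f * g) * (fps_cpow f c * fps_cpow g c)" .
qed (use assms in auto)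

lemma fps_cpow_compose:
  assumes "f $ 0 = 1" "g $ 0 = 0"
  shows "fps_cpow (f oo g) c = fps_cpow f c oo g"
proof -
  have "(f oo g) - 1 = (f - 1) oo g"
    by (simp add: fps_compose_sub_distrib)
  then show ?thesis
    using assms by (simp add: fps_cpow_def fps_compose_assoc)
qed

lemma fps_cpow_linear_nth:
  "fps_cpow (1 - fps_const p * fps_X) (- c) $ n = pochhammer c n / fact n * p ^ n"
proof -
  have "fps_cpow (1 - fps_const p * fps_X) (- c) = fps_binomial (- c) oo (fps_const (- p) * fps_X)"
    by (simp add: fps_cpow_def flip: fps_const_neg)
  then have "fps_cpow (1 - fps_const p * fps_X) (- c) $ n = (- p) ^ n * (- c gchoose n)"
    by (simp del: fps_const_neg)
  also have "\<dots> = ((-1) ^ n * (-1) ^ n) * (pochhammer c n / fact n * p ^ n)"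
    by (simp only: gbinomial_pochhammer power_minus[of p]) simp
  finally show ?thesis
    by (simp flip: power_add)
qed

text \<open>
  Since \<open>h\<close> has no constant term, only the powers up to \<open>h\<^sup>n\<close> reach the coefficient \<open>n\<close>, so a
  factor in front of a composition can be distributed over finitely many terms.
\<close>
lemma fps_mult_compose_nth:
  fixes f g h :: "'a::idom fps"
  assumes "h $ 0 = 0"
  shows "(f * (g oo h)) $ n = (\<Sum>i = 0..n. g $ i * (f * h ^ i) $ n)"
proof -
  have "(g oo h) $ k = (\<Sum>i = 0..n. g $ i * (h ^ i) $ k)" if "k \<le> n" for k
    unfolding fps_compose_nth
    using that assms by (intro sum.mono_neutral_left) (auto simp: startsby_zero_power_prefix)
  then have "(f * (g oo h)) $ n = (\<Sum>k = 0..n. f $ k * (\<Sum>i = 0..n. g $ i * (h ^ i) $ (n - k)))"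
    by (simp add: fps_mult_nth)
  also have "\<dots> = (\<Sum>i = 0..n. \<Sum>k = 0..n. g $ i * (f $ k * (h ^ i) $ (n - k)))"
    by (subst sum.swap) (simp add: sum_distrib_left mult_ac)
  also have "\<dots> = (\<Sum>i = 0..n. g $ i * (f * h ^ i) $ n)"
    by (simp add: fps_mult_nth sum_distrib_left)
  finally show ?thesis .
qed

section \<open>Gegenbauer polynomials as coefficients of powers of a quadratic\<close>

text \<open>
  Homogenised Gegenbauer polynomials. With a second variable \<open>w\<close> the values \<open>1\<close>, \<open>4x\<^sup>2\<close>,
  \<open>x\<^sup>2 - 1\<close> and \<open>(x\<^sup>2 - 1)\<^sup>2\<close> of \<open>w\<close> are covered without square roots or divisions.
\<close>
definition gegenbauer_hom :: "nat \<Rightarrow> complex \<Rightarrow> complex \<Rightarrow> complex \<Rightarrow> complex" where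
  "gegenbauer_hom n b s w =
     (\<Sum>j = 0..n div 2.
        (-1) ^ j * pochhammer b (n - j) / (fact j * fact (n - 2 * j)) * s ^ (n - 2 * j) * w ^ j)"

definition quad_fps :: "complex \<Rightarrow> complex \<Rightarrow> complex fps" where
  "quad_fps s w = 1 - fps_const s * fps_X + fps_const w * fps_X ^ 2"

lemma quad_fps_nth_0 [simp]: "quad_fps s w $ 0 = 1"
  by (simp add: quad_fps_def)

lemma binomial_fps_nth:
  fixes s w :: "'a::comm_ring_1"
  shows "(fps_const s + fps_const w * fps_X) ^ i $ k = of_nat (i choose k) * s ^ (i - k) * w ^ k"
proof -
  have "(fps_const w * fps_X + fps_const s) ^ i $ k
      = (\<Sum>j\<le>i. if k = j then of_nat (i choose j) * s ^ (i - j) * w ^ j else 0)"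
    by (simp add: binomial_ring fps_sum_nth power_mult_distrib fps_const_power
        fps_of_nat[symmetric] mult_delta_right mult_ac cong: sum.cong if_cong)
  then show ?thesis
    by (simp add: add.commute binomial_eq_0)
qed

text \<open>
  The classical generating function: the \<open>i\<close>-th term of the binomial series is
  \<open>t\<^sup>i (w t - s)\<^sup>i\<close> up to a constant, and it contributes to the coefficient \<open>n\<close> with \<open>i = n - j\<close>.
\<close>
lemma fps_cpow_quad_fps_nth:
  "fps_cpow (quad_fps s w) (- b) $ n = gegenbauer_hom n b s w"
proof -
  have "quad_fps s w - 1 = fps_X * (fps_const (- s) + fps_const w * fps_X)"
    by (simp add: quad_fps_def power2_eq_square algebra_simps flip: fps_const_neg)
  then have "fps_cpow (quad_fps s w) (- b) $ n
      = (\<Sum>i = 0..n. (- b gchoose i) * (of_nat (i choose (n - i)) * (- s) ^ (i - (n - i)) * w ^ (n - i)))"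
    unfolding fps_cpow_def fps_compose_nth fps_binomial_nth
    by (intro sum.cong refl)
      (simp add: power_mult_distrib fps_X_power_mult_nth binomial_fps_nth del: fps_const_neg)
  also have "\<dots> = (\<Sum>j = 0..n. (- b gchoose (n - j)) * (of_nat ((n - j) choose j) * (- s) ^ (n - j - j) * w ^ j))"
    by (rule sum.reindex_bij_witness[of _ "\<lambda>j. n - j" "\<lambda>j. n - j"]) auto
  also have "\<dots> = (\<Sum>j = 0..n div 2. (- b gchoose (n - j)) * (of_nat ((n - j) choose j) * (- s) ^ (n - j - j) * w ^ j))"
    by (rule sum.mono_neutral_right) (auto simp: binomial_eq_0)
  also have "\<dots> = gegenbauer_hom n b s w"
    unfolding gegenbauer_hom_def
  proof (rule sum.cong[OF refl])
    fix j assume "j \<in> {0..n div 2}"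
    then obtain m where n: "n = 2 * j + m"
      using le_Suc_ex[of "2 * j" n] by fastforce
    have ch: "of_nat ((j + m) choose j) = (fact (j + m) / (fact j * fact m) :: complex)"
      by (simp add: binomial_fact)
    have "(- b gchoose (n - j)) * (of_nat ((n - j) choose j) * (- s) ^ (n - j - j) * w ^ j)
        = (-1) ^ (j + m) * (-1) ^ m * (pochhammer b (j + m) / (fact j * fact m) * s ^ m * w ^ j)"
      by (simp add: n ch gbinomial_pochhammer power_minus[of s] field_simps)
    then show "(- b gchoose (n - j)) * (of_nat ((n - j) choose j) * (- s) ^ (n - j - j) * w ^ j)
        = (-1) ^ j * pochhammer b (n - j) / (fact j * fact (n - 2 * j)) * s ^ (n - 2 * j) * w ^ j"
      by (simp add: n power_add mult.assoc flip: power_mult_distrib)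
  qed
  finally show ?thesis .
qed

text \<open>
  Here the quadratic is written as \<open>(1 - p t)\<^sup>2 - r t\<^sup>2 = (1 - p t)\<^sup>2 (1 - r t\<^sup>2 / (1 - p t)\<^sup>2)\<close>, and only
  the second factor is expanded by the binomial series.
\<close>
lemma gegenbauer_hom_complete_square:
  "gegenbauer_hom n b (2 * p) (p\<^sup>2 - r) =
     (\<Sum>j = 0..n div 2.
        pochhammer b j * pochhammer (2 * b + 2 * of_nat j) (n - 2 * j)
          / (fact j * fact (n - 2 * j)) * p ^ (n - 2 * j) * r ^ j)"
proof -
  let ?c = "\<lambda>j. pochhammer (2 * b + 2 * of_nat j) (n - 2 * j) / fact (n - 2 * j) * p ^ (n - 2 * j)"
  define u where "u = 1 - fps_const p * fps_X"
  have u0: "u $ 0 = 1" by (simp add: u_def)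
  \<comment> \<open>As a power of \<open>u\<close>, the inverse square merges with \<open>u\<close> to the exponent \<open>-2b\<close> below.\<close>
  define v where "v = fps_cpow u (- 2)"
  have uv: "u\<^sup>2 * v = 1"
    using fps_cpow_add[OF u0, of 2 "-2"] fps_cpow_power[OF u0, of 1 2]
    by (simp add: v_def fps_cpow_1[OF u0])
  define h where "h = fps_const (- r) * fps_X\<^sup>2 * v"
  have h0: "h $ 0 = 0" by (simp add: h_def)
  have quad: "quad_fps (2 * p) (p\<^sup>2 - r) = u\<^sup>2 * (1 + h)"
  proof -
    have "u\<^sup>2 * (1 + h) = u\<^sup>2 + fps_const (- r) * fps_X\<^sup>2 * (u\<^sup>2 * v)"
      by (simp add: h_def algebra_simps)
    then show ?thesis
      by (simp only: uv) (simp add: quad_fps_def u_def power2_eq_square algebra_simps numeral_fps_const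
          flip: fps_const_mult fps_const_sub fps_const_neg)
  qed
  have "fps_cpow (u\<^sup>2) (- b) = fps_cpow u (- (2 * b))"
    using fps_cpow_add[OF u0, of "- b" "- b"] u0
    by (simp add: fps_cpow_mult power2_eq_square)
  then have "fps_cpow (quad_fps (2 * p) (p\<^sup>2 - r)) (- b)
      = fps_cpow u (- (2 * b)) * (fps_binomial (- b) oo h)"
    using u0 h0 fps_cpow_mult[of "u\<^sup>2" "1 + h" "- b"]
    by (simp add: quad fps_power_zeroth) (simp add: fps_cpow_def)
  then have "gegenbauer_hom n b (2 * p) (p\<^sup>2 - r)
      = (\<Sum>j = 0..n. (- b gchoose j) * (fps_cpow u (- (2 * b)) * h ^ j) $ n)"
    by (simp add: fps_mult_compose_nth[OF h0] flip: fps_cpow_quad_fps_nth)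
  also have "\<dots> = (\<Sum>j = 0..n. (- b gchoose j) * (- r) ^ j *
      (if 2 * j \<le> n then ?c j else 0))"
  proof (rule sum.cong[OF refl])
    fix j
    have "fps_cpow u (- (2 * b)) * h ^ j
        = fps_const ((- r) ^ j) * (fps_X ^ (2 * j) * (fps_cpow u (- (2 * b)) * v ^ j))"
      by (simp only: h_def power_mult_distrib fps_const_power mult_ac flip: power_mult)
    also have "fps_cpow u (- (2 * b)) * v ^ j = fps_cpow u (- (2 * b + 2 * of_nat j))"
      using fps_cpow_add[OF u0, of "- (2 * b)" "of_nat j * (- 2)"]
      by (simp add: v_def fps_cpow_power[OF u0] algebra_simps)
    finally show "(- b gchoose j) * (fps_cpow u (- (2 * b)) * h ^ j) $ n =
      (- b gchoose j) * (- r) ^ j *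
      (if 2 * j \<le> n then ?c j else 0)"
      by (simp only: fps_mult_left_const_nth fps_X_power_mult_nth u_def fps_cpow_linear_nth) simp
  qed
  also have "\<dots> = (\<Sum>j = 0..n div 2. (- b gchoose j) * (- r) ^ j *
      (if 2 * j \<le> n then ?c j else 0))"
    by (rule sum.mono_neutral_right) auto
  also have "\<dots> = (\<Sum>j = 0..n div 2.
        pochhammer b j * pochhammer (2 * b + 2 * of_nat j) (n - 2 * j)
          / (fact j * fact (n - 2 * j)) * p ^ (n - 2 * j) * r ^ j)"
  proof (rule sum.cong[OF refl])
    fix j assume j: "j \<in> {0..n div 2}"
    have "(- b gchoose j) * (- r) ^ j = ((-1) ^ j * (-1) ^ j) * (pochhammer b j / fact j * r ^ j)"
      by (simp only: gbinomial_pochhammer power_minus[of r]) simp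
    then have "(- b gchoose j) * (- r) ^ j = pochhammer b j / fact j * r ^ j"
      by (simp flip: power_add)
    then show "(- b gchoose j) * (- r) ^ j *
      (if 2 * j \<le> n then ?c j else 0)
      = pochhammer b j * pochhammer (2 * b + 2 * of_nat j) (n - 2 * j)
          / (fact j * fact (n - 2 * j)) * p ^ (n - 2 * j) * r ^ j"
      using j by (auto simp: mult_ac)
  qed
  finally show ?thesis .
qed

section \<open>The reflection law\<close>

text \<open>
  This compares the coefficients of the two expansions of a quadratic power. The first and the last
  factor on the left multiply to the Pochhammer symbol of \<open>2b + 2j\<close> with index \<open>2(j + m)\<close>, to which the
  duplication formula applies.
\<close>
lemma pochhammer_reflection_coeff:
  fixes b :: "'a::field_char_0"
  shows "pochhammer (2 * b + of_nat (2 * j + m)) (2 * j + m)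
           * (pochhammer b j * pochhammer (2 * b + 2 * of_nat j) m)
         = 4 ^ (j + m) * (pochhammer b (2 * j + m) * pochhammer (b + 1/2 + of_nat j) (j + m))"
proof -
  have "pochhammer (2 * b + 2 * of_nat j) m * pochhammer (2 * b + of_nat (2 * j + m)) (2 * j + m)
      = pochhammer (2 * (b + of_nat j)) (2 * (j + m))"
    using pochhammer_product'[of "2 * b + 2 * of_nat j" m "2 * j + m"]
    by (simp add: algebra_simps)
  also have "\<dots> = 4 ^ (j + m) * pochhammer (b + of_nat j) (j + m) * pochhammer (b + 1/2 + of_nat j) (j + m)"
    unfolding pochhammer_double power_mult by (simp add: add_ac)
  finally have "pochhammer (2 * b + 2 * of_nat j) m * pochhammer (2 * b + of_nat (2 * j + m)) (2 * j + m) * pochhammer b j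
      = 4 ^ (j + m) * (pochhammer b j * pochhammer (b + of_nat j) (j + m)) * pochhammer (b + 1/2 + of_nat j) (j + m)"
    by (simp add: mult_ac)
  also have "pochhammer b j * pochhammer (b + of_nat j) (j + m) = pochhammer b (2 * j + m)"
    using pochhammer_product'[of b j "j + m"] by (simp add: mult_2 add.assoc)
  finally show ?thesis by (simp add: mult_ac)
qed

text \<open>
  The left-hand side is expanded by completing the square, the right-hand side by the defining sum;
  the two sums agree term by term.
\<close>
lemma gegenbauer_hom_reflection:
  "pochhammer (2 * b + of_nat n) n * gegenbauer_hom n b s w
     = (-2) ^ n * pochhammer b n * gegenbauer_hom n (1/2 - b - of_nat n) s (s\<^sup>2 / 4 - w)"
proof -
  define r where "r = s\<^sup>2 / 4 - w"
  have "gegenbauer_hom n b s w = (\<Sum>j = 0..n div 2.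
        pochhammer b j * pochhammer (2 * b + 2 * of_nat j) (n - 2 * j)
          / (fact j * fact (n - 2 * j)) * (s / 2) ^ (n - 2 * j) * r ^ j)"
    using gegenbauer_hom_complete_square[of n b "s / 2" r] by (simp add: r_def power_divide)
  then have "pochhammer (2 * b + of_nat n) n * gegenbauer_hom n b s w = (\<Sum>j = 0..n div 2.
        pochhammer (2 * b + of_nat n) n * (pochhammer b j * pochhammer (2 * b + 2 * of_nat j) (n - 2 * j)
          / (fact j * fact (n - 2 * j)) * (s / 2) ^ (n - 2 * j) * r ^ j))"
    by (simp add: sum_distrib_left)
  also have "\<dots> = (\<Sum>j = 0..n div 2. (-2) ^ n * pochhammer b n *
        ((-1) ^ j * pochhammer (1/2 - b - of_nat n) (n - j)
           / (fact j * fact (n - 2 * j)) * s ^ (n - 2 * j) * r ^ j))"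
  proof (rule sum.cong[OF refl])
    fix j assume "j \<in> {0..n div 2}"
    then obtain m where n: "n = 2 * j + m"
      using le_Suc_ex[of "2 * j" n] by fastforce
    have minus: "pochhammer (1/2 - b - of_nat n) (j + m) = (-1) ^ (j + m) * pochhammer (b + 1/2 + of_nat j) (j + m)"
      using pochhammer_minus[of "b + of_nat n - 1/2" "j + m"] by (simp add: n algebra_simps)
    have sign: "(-2) ^ n * ((-1) ^ j * (-1) ^ (j + m)) * 2 ^ m = (4::complex) ^ (j + m)"
    proof -
      have "(-2) ^ n * ((-1) ^ j * (-1) ^ (j + m)) * 2 ^ m
          = ((-2) * (-2)) ^ j * ((-2) * (-1) * 2) ^ m * ((-1) * (-1 :: complex)) ^ j"
        unfolding n power_add power_mult_distrib mult_2 by (simp only: mult_ac)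
      then show ?thesis by (simp add: power_add)
    qed
    have "pochhammer (2 * b + of_nat n) n * (pochhammer b j * pochhammer (2 * b + 2 * of_nat j) m
          / (fact j * fact m) * (s / 2) ^ m * r ^ j)
        = (pochhammer (2 * b + of_nat n) n * (pochhammer b j * pochhammer (2 * b + 2 * of_nat j) m))
          / 2 ^ m / (fact j * fact m) * s ^ m * r ^ j"
      by (simp add: power_divide mult_ac)
    also have "\<dots> = (-2) ^ n * pochhammer b n * ((-1) ^ j * ((-1) ^ (j + m) * pochhammer (b + 1/2 + of_nat j) (j + m))
           / (fact j * fact m) * s ^ m * r ^ j)"
      unfolding n pochhammer_reflection_coeff sign[unfolded n, symmetric] by simp
    finally show "pochhammer (2 * b + of_nat n) n * (pochhammer b j * pochhammer (2 * b + 2 * of_nat j) (n - 2 * j)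
          / (fact j * fact (n - 2 * j)) * (s / 2) ^ (n - 2 * j) * r ^ j)
        = (-2) ^ n * pochhammer b n * ((-1) ^ j * pochhammer (1/2 - b - of_nat n) (n - j)
           / (fact j * fact (n - 2 * j)) * s ^ (n - 2 * j) * r ^ j)"
      using minus by (simp add: n)
  qed
  also have "\<dots> = (-2) ^ n * pochhammer b n * gegenbauer_hom n (1/2 - b - of_nat n) s r"
    by (simp only: gegenbauer_hom_def sum_distrib_left)
  finally show ?thesis by (simp add: r_def)
qed

text \<open>
  The case \<open>c = -1\<close> gives the parity in \<open>s\<close>, the case \<open>c = 2x\<close> clears the denominator of
  \<open>(1 + x\<^sup>2)/(2x)\<close>.
\<close>
lemma gegenbauer_hom_scale:
  "gegenbauer_hom n b (c * s) (c\<^sup>2 * w) = c ^ n * gegenbauer_hom n b s w"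
  unfolding gegenbauer_hom_def sum_distrib_left
proof (rule sum.cong[OF refl])
  fix j assume "j \<in> {0..n div 2}"
  then have "c ^ n = c ^ (n - 2 * j) * (c\<^sup>2) ^ j"
    by (simp flip: power_mult power_add)
  then show "(-1) ^ j * pochhammer b (n - j) / (fact j * fact (n - 2 * j)) * (c * s) ^ (n - 2 * j) * (c\<^sup>2 * w) ^ j
     = c ^ n * ((-1) ^ j * pochhammer b (n - j) / (fact j * fact (n - 2 * j)) * s ^ (n - 2 * j) * w ^ j)"
    by (simp add: power_mult_distrib)
qed

lemma gegenbauer_eq_hom: "gegenbauer n b x = gegenbauer_hom n b (2 * x) 1"
  by (simp add: gegenbauer_def gegenbauer_hom_def)

lemma gegenbauer_reflection:
  "pochhammer (2 * b + of_nat n) n * gegenbauer n b x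
     = (-2) ^ n * pochhammer b n * gegenbauer_hom n (1/2 - b - of_nat n) (2 * x) (x\<^sup>2 - 1)"
  using gegenbauer_hom_reflection[of b n "2 * x" 1]
  by (simp add: gegenbauer_eq_hom)

text \<open>
  The same law read from the other side, since \<open>b \<mapsto> 1/2 - b - n\<close> is an involution. This version makes the
  parameter \<open>b\<close> on the right independent of \<open>n\<close> when the Gegenbauer parameter decreases with the degree.
\<close>
lemma gegenbauer_reflection':
  "pochhammer (2 * b) n * gegenbauer n (1/2 - b - of_nat n) x
     = (-2) ^ n * pochhammer (b + 1/2) n * gegenbauer_hom n b (2 * x) (x\<^sup>2 - 1)"
proof -
  have "2 * (1/2 - b - of_nat n) + of_nat n = - (2 * b + of_nat n - 1)"
    by (simp add: algebra_simps)
  then have "pochhammer (2 * (1/2 - b - of_nat n) + of_nat n) n = (-1) ^ n * pochhammer (2 * b) n"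
    using pochhammer_minus[of "2 * b + of_nat n - 1" n] by (simp add: diff_diff_eq)
  moreover have "pochhammer (1/2 - b - of_nat n) n = (-1) ^ n * pochhammer (b + 1/2) n"
    using pochhammer_minus[of "b + of_nat n - 1/2" n] by (simp add: algebra_simps)
  moreover have "1/2 - (1/2 - b - of_nat n) - of_nat n = b"
    by simp
  ultimately have "(-1) ^ n * (pochhammer (2 * b) n * gegenbauer n (1/2 - b - of_nat n) x)
      = (-1) ^ n * ((-2) ^ n * pochhammer (b + 1/2) n * gegenbauer_hom n b (2 * x) (x\<^sup>2 - 1))"
    using gegenbauer_reflection[of "1/2 - b - of_nat n" n x] by (simp only: mult_ac)
  then show ?thesis
    by simp
qed

text \<open>
  The argument \<open>(1 + x\<^sup>2)/(2x)\<close>, the Joukowski map, is the mean of \<open>x\<close> and \<open>1/x\<close>. With \<open>s = 2(x\<^sup>2 + 1)\<close> and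
  \<open>w = 4x\<^sup>2\<close> the reflected value \<open>s\<^sup>2/4 - w\<close> is the perfect square \<open>(x\<^sup>2 - 1)\<^sup>2\<close>.
\<close>
lemma gegenbauer_joukowski_reflection:
  assumes "x \<noteq> 0"
  shows "pochhammer (2 * b + of_nat n) n * (x ^ n * gegenbauer n b ((1 + x\<^sup>2) / (2 * x)))
     = (-1) ^ n * pochhammer b n
         * gegenbauer_hom n (1/2 - b - of_nat n) (2 * (x\<^sup>2 + 1)) ((x\<^sup>2 - 1)\<^sup>2)"
proof -
  have "(2 * x) ^ n * gegenbauer n b ((1 + x\<^sup>2) / (2 * x)) = gegenbauer_hom n b (2 * (x\<^sup>2 + 1)) (4 * x\<^sup>2)"
    using assms gegenbauer_hom_scale[of n b "2 * x" "2 * ((1 + x\<^sup>2) / (2 * x))" 1]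
    by (simp add: gegenbauer_eq_hom power_mult_distrib add.commute)
  moreover have "(2 * (x\<^sup>2 + 1))\<^sup>2 / 4 - 4 * x\<^sup>2 = (x\<^sup>2 - 1)\<^sup>2"
    by (simp add: power2_eq_square algebra_simps)
  ultimately have "pochhammer (2 * b + of_nat n) n * ((2 * x) ^ n * gegenbauer n b ((1 + x\<^sup>2) / (2 * x)))
     = (-2) ^ n * pochhammer b n
         * gegenbauer_hom n (1/2 - b - of_nat n) (2 * (x\<^sup>2 + 1)) ((x\<^sup>2 - 1)\<^sup>2)"
    using gegenbauer_hom_reflection[of b n "2 * (x\<^sup>2 + 1)" "4 * x\<^sup>2"] by simp
  then have "2 ^ n * (pochhammer (2 * b + of_nat n) n * (x ^ n * gegenbauer n b ((1 + x\<^sup>2) / (2 * x))))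
     = 2 ^ n * ((-1) ^ n * pochhammer b n
         * gegenbauer_hom n (1/2 - b - of_nat n) (2 * (x\<^sup>2 + 1)) ((x\<^sup>2 - 1)\<^sup>2))"
    unfolding power_mult_distrib[of 2 x] power_minus[of "2 :: complex" n] by (simp only: mult_ac)
  then show ?thesis by simp
qed

section \<open>Convolutions from the factorisation of an even quartic\<close>

lemma fps_compose_X_squared_nth:
  fixes f :: "'a::comm_ring_1 fps"
  shows "(f oo fps_X\<^sup>2) $ n = (if even n then f $ (n div 2) else 0)"
proof -
  have "(f oo fps_X\<^sup>2) $ n = (\<Sum>i = 0..n. if even n \<and> i = n div 2 then f $ i else 0)"
    unfolding fps_compose_nth by (intro sum.cong refl) (auto simp flip: power_mult)
  then show ?thesis by (cases "even n") (simp_all)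
qed

lemma quad_fps_mult_reflect:
  "quad_fps s w * quad_fps (- s) w = quad_fps (s\<^sup>2 - 2 * w) (w\<^sup>2) oo fps_X\<^sup>2"
proof -
  have "quad_fps (s\<^sup>2 - 2 * w) (w\<^sup>2) oo fps_X\<^sup>2
      = 1 - fps_const (s\<^sup>2 - 2 * w) * fps_X\<^sup>2 + fps_const (w\<^sup>2) * (fps_X\<^sup>2)\<^sup>2"
    by (simp add: quad_fps_def fps_compose_add_distrib fps_compose_sub_distrib
        fps_compose_mult_distrib flip: fps_compose_power)
  then show ?thesis
    by (simp add: quad_fps_def power2_eq_square algebra_simps numeral_fps_const
        flip: fps_const_mult fps_const_sub fps_const_neg)
qed

text \<open>
  For \<open>A(t) = 1 - s t + w t\<^sup>2\<close>, powers of \<open>A(t)\<close> and \<open>A(-t)\<close> with the same exponent multiply to a power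
  of an even polynomial; the signs come from \<open>A(-t)\<close>.
\<close>
lemma gegenbauer_hom_convolution_same:
  "(\<Sum>n = 0..2 * l. (-1) ^ n * gegenbauer_hom n b s w * gegenbauer_hom (2 * l - n) b s w)
     = gegenbauer_hom l b (s\<^sup>2 - 2 * w) (w\<^sup>2)"
proof -
  have "gegenbauer_hom l b (s\<^sup>2 - 2 * w) (w\<^sup>2)
      = fps_cpow (quad_fps (s\<^sup>2 - 2 * w) (w\<^sup>2) oo fps_X\<^sup>2) (- b) $ (2 * l)"
    by (simp add: fps_cpow_compose fps_compose_X_squared_nth fps_cpow_quad_fps_nth)
  also have "\<dots> = (fps_cpow (quad_fps s w) (- b) * fps_cpow (quad_fps (- s) w) (- b)) $ (2 * l)"
    by (simp add: fps_cpow_mult flip: quad_fps_mult_reflect)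
  also have "\<dots> = (fps_cpow (quad_fps (- s) w) (- b) * fps_cpow (quad_fps s w) (- b)) $ (2 * l)"
    by (subst mult.commute) (rule refl)
  also have "\<dots> = (\<Sum>n = 0..2 * l. (-1) ^ n * gegenbauer_hom n b s w * gegenbauer_hom (2 * l - n) b s w)"
    using gegenbauer_hom_scale[of _ b "-1" s w]
    by (simp add: fps_mult_nth fps_cpow_quad_fps_nth)
  finally show ?thesis ..
qed

text \<open>
  For \<open>A(t) = 1 - s t + w t\<^sup>2\<close>, the product of \<open>A(t)\<^sup>-\<^sup>b\<close> and \<open>(A(t) A(-t))\<^sup>b\<close> leaves \<open>A(-t)\<^sup>b\<close>.
\<close>
lemma gegenbauer_hom_convolution_opposite:
  "(\<Sum>m = 0..k div 2. gegenbauer_hom (k - 2 * m) b s w * gegenbauer_hom m (- b) (s\<^sup>2 - 2 * w) (w\<^sup>2))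
     = (-1) ^ k * gegenbauer_hom k (- b) s w"
proof -
  let ?A = "quad_fps s w" and ?A' = "quad_fps (- s) w" and ?P = "quad_fps (s\<^sup>2 - 2 * w) (w\<^sup>2)"
  have "fps_cpow ?A (- b) * (fps_cpow ?P b oo fps_X\<^sup>2) = fps_cpow ?A (- b) * (fps_cpow ?A b * fps_cpow ?A' b)"
    by (simp add: fps_cpow_mult flip: quad_fps_mult_reflect fps_cpow_compose)
  also have "\<dots> = fps_cpow ?A' b"
    using fps_cpow_add[of ?A "- b" b] by (simp flip: mult.assoc)
  finally have "fps_cpow ?A' b $ k = ((fps_cpow ?P b oo fps_X\<^sup>2) * fps_cpow ?A (- b)) $ k"
    by (simp add: mult.commute)
  also have "\<dots> = (\<Sum>i = 0..k. if even i then fps_cpow ?P b $ (i div 2) * fps_cpow ?A (- b) $ (k - i) else 0)"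
    unfolding fps_mult_nth fps_compose_X_squared_nth by (intro sum.cong) auto
  also have "\<dots> = (\<Sum>i \<in> (*) 2 ` {0..k div 2}. if even i then fps_cpow ?P b $ (i div 2) * fps_cpow ?A (- b) $ (k - i) else 0)"
    by (rule sum.mono_neutral_right) (auto elim!: evenE)
  also have "\<dots> = (\<Sum>m = 0..k div 2. fps_cpow ?P b $ m * fps_cpow ?A (- b) $ (k - 2 * m))"
    by (subst sum.reindex) (auto simp: inj_on_def)
  also have "\<dots> = (\<Sum>m = 0..k div 2. gegenbauer_hom (k - 2 * m) b s w * gegenbauer_hom m (- b) (s\<^sup>2 - 2 * w) (w\<^sup>2))"
    using fps_cpow_quad_fps_nth[of _ _ "- b"] by (simp add: fps_cpow_quad_fps_nth mult.commute)
  finally show ?thesis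
    using gegenbauer_hom_scale[of k "- b" "-1" s w] fps_cpow_quad_fps_nth[of "- s" w "- b" k]
    by simp
qed

section \<open>The two expansions\<close>

text \<open>
  This is \<open>(a)\<^sub>n\<^sub>-\<^sub>l (a + n - l)\<^sub>2\<^sub>l\<^sub>-\<^sub>n = (a)\<^sub>l\<close>, the additivity of Pochhammer symbols, when the
  first index may be negative.
\<close>
lemma poch_int_mult_pochhammer:
  assumes "poch_int_defined a (int n - int l)" and "n \<le> 2 * l"
  shows "poch_int a (int n - int l) * pochhammer (a + of_nat n - of_nat l) (2 * l - n) = pochhammer a l"
proof (cases "l \<le> n")
  case True
  then have "poch_int a (int n - int l) = pochhammer a (n - l)"
    by (simp add: poch_int_def nat_diff_distrib)
  moreover have "pochhammer a l = pochhammer a (n - l) * pochhammer (a + of_nat (n - l)) (l - (n - l))"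
    using assms(2) by (intro pochhammer_product) auto
  ultimately show ?thesis
    using True by (simp add: of_nat_diff add_diff_eq mult_2)
next
  case False
  then obtain d where l: "l = n + d" and d: "d > 0"
    by (metis less_imp_add_positive not_le)
  have "(\<Prod>i = 1..d. a - of_nat i) = pochhammer (a - of_nat d) d"
    unfolding pochhammer_prod_rev by (intro prod.cong refl) (simp add: of_nat_diff)
  moreover have "pochhammer (a - of_nat d) (2 * l - n) = pochhammer (a - of_nat d) d * pochhammer a l"
    using pochhammer_product[of d "2 * l - n" "a - of_nat d"] by (simp add: l add.commute[of d n])
  ultimately show ?thesis
    using assms(1) d by (simp add: l poch_int_def poch_int_defined_def)
qed

text \<open>
  One denominator of \<open>\<Lambda>\<^sub>1\<close> cancels against the reflection of the polynomial in \<open>x\<close>. The other one is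
  the initial part of the product \<open>W\<close>, and its final part is exactly the factor that the reflection of
  the polynomial in \<open>(1 + x\<^sup>2)/(2x)\<close> asks for. Hence multiplication by \<open>W\<close> gives each term the same
  constant \<open>2\<^sup>k V\<close>, and the convolution with opposite exponents sums the rest.
\<close>
lemma gegenbauer_expansion_mixed_arguments:
  fixes x :: complex
  assumes "\<And>m. m \<le> k div 2 \<Longrightarrow> Lambda1_defined k m \<mu>" and x: "x \<noteq> 0"
  shows "gegenbauer k (\<mu> + 1/2) x =
           (\<Sum>m = 0..k div 2.
              Lambda1 k m \<mu> / (x powi (- int m))
              * gegenbauer (k - 2 * m) (1/2 - 2 * of_nat k + 2 * of_nat m - \<mu>) x
              * gegenbauer m (of_nat k - of_nat m + \<mu> + 1/2) ((1 + x\<^sup>2) / (2 * x)))"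
    (is "_ = (\<Sum>m = 0..k div 2. ?term m)")
proof -
  define b where "b = \<mu> + of_nat k"
  define W where "W = pochhammer (2 * \<mu> + of_nat k + 1) k"
  define V where "V = pochhammer (\<mu> + 1/2) k"
  let ?P = "\<lambda>m. gegenbauer_hom m (- b) (2 * (x\<^sup>2 + 1)) ((x\<^sup>2 - 1)\<^sup>2)"
  \<comment> \<open>\<open>W\<close> is itself one of the denominators, namely at \<open>m = 0\<close>.\<close>
  have "W \<noteq> 0"
    using assms(1)[of 0] by (simp add: Lambda1_defined_def W_def)
  have "W * ?term m = 2 ^ k * V * (gegenbauer_hom (k - 2 * m) b (2 * x) (x\<^sup>2 - 1) * ?P m)"
    if m: "m \<in> {0..k div 2}" for m
  proof -
    obtain n where k: "k = 2 * m + n"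
      using m le_Suc_ex[of "2 * m" k] by fastforce
    then have km: "m + n + m = k"
      by simp
    define d1 where "d1 = pochhammer (b + 1/2) n"
    define d2 where "d2 = pochhammer (2 * \<mu> + of_nat k + 1) (m + n)"
    define L where "L = pochhammer (\<mu> + 1/2) (m + n)"
    define M where "M = pochhammer (of_nat k - of_nat m + \<mu> + 1/2) m"
    define Q where "Q = pochhammer (2 * (of_nat k - of_nat m + \<mu> + 1/2) + of_nat m) m"
    define C where "C = gegenbauer n (1/2 - 2 * of_nat k + 2 * of_nat m - \<mu>) x"
    define D where "D = gegenbauer m (of_nat k - of_nat m + \<mu> + 1/2) ((1 + x\<^sup>2) / (2 * x))"
    define T where "T = gegenbauer_hom n b (2 * x) (x\<^sup>2 - 1)"
    have nz: "d1 \<noteq> 0" "d2 \<noteq> 0"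
      using assms(1)[of m] m
      by (auto simp: Lambda1_defined_def d1_def d2_def b_def k algebra_simps)
    have C: "pochhammer (2 * b) n * C = (-2) ^ n * d1 * T"
      using gegenbauer_reflection'[of b n x] by (simp add: C_def T_def d1_def b_def k algebra_simps)
    have D: "Q * (x ^ m * D) = (-1) ^ m * M * ?P m"
      using gegenbauer_joukowski_reflection[OF x, of "of_nat k - of_nat m + \<mu> + 1/2" m]
      by (simp add: Q_def D_def M_def b_def k algebra_simps)
    have W: "W = d2 * Q"
      using pochhammer_product'[of "2 * \<mu> + of_nat k + 1" "m + n" m, unfolded km]
      by (simp add: W_def d2_def Q_def) (simp add: k algebra_simps)
    have V: "V = L * M"
      using pochhammer_product'[of "\<mu> + 1/2" "m + n" m, unfolded km]
      by (simp add: V_def L_def M_def) (simp add: k algebra_simps)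
    have "?term m = (-1) ^ (k + m) * 4 ^ m * pochhammer (2 * b) n * L / (d1 * d2) * x ^ m * C * D"
    proof -
      have idx: "k - 2 * m = n" "k - m = m + n"
        using k by simp_all
      have arg: "2 * of_nat k + 2 * \<mu> = 2 * b" "1/2 + \<mu> + of_nat k = b + 1/2"
        by (simp_all add: b_def)
      have "Lambda1 k m \<mu> = (-1) ^ (k + m) * 4 ^ m * pochhammer (2 * b) n * L / (d1 * d2)"
        unfolding Lambda1_def idx arg d1_def d2_def L_def by (simp add: power_mult)
      moreover have "c / (x powi (- int m)) = c * x ^ m" for c
        by (simp add: power_int_minus divide_inverse)
      ultimately show ?thesis
        unfolding idx C_def D_def by (simp only:)
    qed
    then have "W * ?term m = (-1) ^ (k + m) * 4 ^ m * L * ((pochhammer (2 * b) n * C) / d1) * (Q * (x ^ m * D))"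
      using nz by (simp add: W)
    also have "\<dots> = ((-1) ^ (k + m) * (-1) ^ m * 4 ^ m * (-2) ^ n) * V * (T * ?P m)"
      using nz unfolding C D V by simp
    also have "(-1) ^ (k + m) * (-1) ^ m * 4 ^ m * (-2) ^ n = (2 ^ k :: complex)"
    proof -
      have "(-1) ^ (k + m) * (-1) ^ m * 4 ^ m * (-2) ^ n
          = ((-1) * (-1) * 4) ^ m * ((-1) * (-2)) ^ n * ((-1) * (-1 :: complex)) ^ m"
        unfolding k power_add power_mult_distrib mult_2 by (simp only: mult_ac)
      also have "\<dots> = (2 ^ k :: complex)"
        by (simp add: k power_add power_mult)
      finally show ?thesis .
    qed
    finally show ?thesis by (simp add: T_def k)
  qed
  then have "W * (\<Sum>m = 0..k div 2. ?term m)
      = 2 ^ k * V * (\<Sum>m = 0..k div 2. gegenbauer_hom (k - 2 * m) b (2 * x) (x\<^sup>2 - 1) * ?P m)"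
    unfolding sum_distrib_left by (rule sum.cong[OF refl])
  also have "(\<Sum>m = 0..k div 2. gegenbauer_hom (k - 2 * m) b (2 * x) (x\<^sup>2 - 1) * ?P m)
      = (-1) ^ k * gegenbauer_hom k (- b) (2 * x) (x\<^sup>2 - 1)"
    using gegenbauer_hom_convolution_opposite[of k b "2 * x" "x\<^sup>2 - 1"]
    by (simp add: power2_eq_square algebra_simps)
  also have "2 ^ k * V * \<dots> = W * gegenbauer k (\<mu> + 1/2) x"
    using gegenbauer_reflection[of "\<mu> + 1/2" k x] power_minus[of "2 :: complex" k]
    by (simp add: W_def V_def b_def algebra_simps)
  finally show ?thesis
    using \<open>W \<noteq> 0\<close> by simp
qed

text \<open>
  Both Gegenbauer factors of a term reflect to the same parameter \<open>b = -2l - \<mu>\<close>, one by either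
  reading of the reflection law, so that the convolution with equal exponents applies.
\<close>
lemma gegenbauer_joukowski_expansion_products:
  fixes x :: complex
  assumes "\<And>n. n \<le> 2 * l \<Longrightarrow> Lambda2_defined l n \<mu>" and x: "x \<noteq> 0"
  shows "x ^ l * gegenbauer l (\<mu> + of_nat l + 1/2) ((1 + x\<^sup>2) / (2 * x)) =
           (\<Sum>n = 0..2 * l.
              Lambda2 l n \<mu>
              * gegenbauer n (1/2 + 2 * of_nat l + \<mu> - of_nat n) x
              * gegenbauer (2 * l - n) (\<mu> + of_nat n + 1/2) x)"
    (is "?lhs = (\<Sum>n = 0..2 * l. ?term n)")
proof -
  define b where "b = - 2 * of_nat l - \<mu>"
  define W where "W = pochhammer (2 * \<mu> + 3 * of_nat l + 1) l"
  define V where "V = pochhammer (\<mu> + of_nat l + 1/2) l"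
  let ?T = "\<lambda>n. gegenbauer_hom n b (2 * x) (x\<^sup>2 - 1)"
  \<comment> \<open>\<open>W\<close> is itself one of the denominators, namely at \<open>n = 2l\<close>.\<close>
  have "W \<noteq> 0"
    using assms(1)[of "2 * l"] by (simp add: Lambda2_defined_def W_def poch_int_def)
  have "W * ?term n = (-1) ^ l * V * ((-1) ^ n * ?T n * ?T (2 * l - n))"
    if n: "n \<in> {0..2 * l}" for n
  proof -
    obtain m where l: "2 * l = n + m"
      using n le_Suc_ex[of n "2 * l"] by auto
    then have m: "2 * l - n = m"
      by simp
    have l': "2 * of_nat l = of_nat n + (of_nat m :: complex)"
      using arg_cong[OF l, of "of_nat :: nat \<Rightarrow> complex"] by simp
    then have b: "b = 1/2 - (\<mu> + of_nat n + 1/2) - of_nat m"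
      by (simp add: b_def algebra_simps)
    define d1 where "d1 = pochhammer (b + 1/2) n"
    define d2 where "d2 = poch_int (2 * \<mu> + 3 * of_nat l + 1) (int n - int l)"
    define L where "L = poch_int (\<mu> + of_nat l + 1/2) (int n - int l)"
    define M where "M = pochhammer (\<mu> + of_nat n + 1/2) m"
    define Q where "Q = pochhammer (2 * (\<mu> + of_nat n + 1/2) + of_nat m) m"
    define C where "C = gegenbauer n (1/2 + 2 * of_nat l + \<mu> - of_nat n) x"
    define D where "D = gegenbauer m (\<mu> + of_nat n + 1/2) x"
    have nz: "d1 \<noteq> 0" "d2 \<noteq> 0"
      using assms(1)[of n] n
      by (auto simp: Lambda2_defined_def d1_def d2_def b_def algebra_simps)
    have C: "pochhammer (2 * b) n * C = (-2) ^ n * d1 * ?T n"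
      using gegenbauer_reflection'[of b n x] by (simp add: C_def d1_def b_def algebra_simps)
    have D: "Q * D = (-2) ^ m * M * ?T m"
      using gegenbauer_reflection[of "\<mu> + of_nat n + 1/2" m x]
      by (simp add: Q_def D_def M_def b)
    have W: "W = d2 * Q"
    proof -
      have arg: "2 * \<mu> + 3 * of_nat l + 1 + of_nat n - of_nat l = 2 * (\<mu> + of_nat n + 1/2) + of_nat m"
        using l' by (simp add: algebra_simps)
      have "poch_int_defined (2 * \<mu> + 3 * of_nat l + 1) (int n - int l)"
        using assms(1)[of n] n by (simp add: Lambda2_defined_def)
      from poch_int_mult_pochhammer[OF this] n show ?thesis
        unfolding W_def d2_def Q_def arg by (simp add: l)
    qed
    have V: "V = L * M"
    proof -
      have arg: "\<mu> + of_nat l + 1/2 + of_nat n - of_nat l = \<mu> + of_nat n + 1/2"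
        by simp
      have "poch_int_defined (\<mu> + of_nat l + 1/2) (int n - int l)"
        using assms(1)[of n] n by (simp add: Lambda2_defined_def)
      from poch_int_mult_pochhammer[OF this] n show ?thesis
        unfolding V_def L_def M_def arg by (simp add: l)
    qed
    have "?term n = (-1) ^ (n + l) * pochhammer (2 * b) n * L / (2 ^ (2 * l) * d1 * d2) * C * D"
    proof -
      have arg: "- 4 * of_nat l - 2 * \<mu> = 2 * b" "1/2 - 2 * of_nat l - \<mu> = b + 1/2"
        by (simp_all add: b_def)
      show ?thesis
        unfolding Lambda2_def m arg d1_def d2_def L_def C_def D_def by simp
    qed
    then have "W * ?term n = (-1) ^ (n + l) / 2 ^ (2 * l) * L * ((pochhammer (2 * b) n * C) / d1) * (Q * D)"
      using nz by (simp add: W)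
    also have "\<dots> = ((-1) ^ (n + l) * ((-2) ^ n * (-2) ^ m) / 2 ^ (2 * l)) * V * (?T n * ?T m)"
      using nz unfolding C D V by simp
    also have "(-2) ^ n * (-2) ^ m = (2 ^ (2 * l) :: complex)"
      by (simp flip: power_add l)
    finally show ?thesis by (simp add: m power_add)
  qed
  then have "W * (\<Sum>n = 0..2 * l. ?term n)
      = (-1) ^ l * V * (\<Sum>n = 0..2 * l. (-1) ^ n * ?T n * ?T (2 * l - n))"
    unfolding sum_distrib_left by (rule sum.cong[OF refl])
  also have "(\<Sum>n = 0..2 * l. (-1) ^ n * ?T n * ?T (2 * l - n))
      = gegenbauer_hom l b (2 * (x\<^sup>2 + 1)) ((x\<^sup>2 - 1)\<^sup>2)"
    using gegenbauer_hom_convolution_same[of b "2 * x" "x\<^sup>2 - 1" l]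
    by (simp add: power2_eq_square algebra_simps)
  also have "(-1) ^ l * V * \<dots> = W * ?lhs"
  proof -
    have "b = 1/2 - (\<mu> + of_nat l + 1/2) - of_nat l"
      by (simp add: b_def algebra_simps)
    moreover have "W = pochhammer (2 * (\<mu> + of_nat l + 1/2) + of_nat l) l"
      by (simp add: W_def algebra_simps)
    ultimately show ?thesis
      using gegenbauer_joukowski_reflection[OF x, of "\<mu> + of_nat l + 1/2" l]
      unfolding V_def by metis
  qed
  finally have "W * (\<Sum>n = 0..2 * l. ?term n) = W * ?lhs" .
  then show ?thesis
    by (rule mult_left_cancel[OF \<open>W \<noteq> 0\<close>, THEN iffD1, symmetric])
qed

theorem corollary20:
  fixes k l :: nat and \<mu> :: complex and x :: real
  assumes "\<And>m. m \<le> k div 2 \<Longrightarrow> Lambda1_defined k m \<mu>"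
    and "\<And>n. n \<le> 2 * l \<Longrightarrow> Lambda2_defined l n \<mu>"
    and "x \<noteq> 0"
  shows "gegenbauer k (\<mu> + 1/2) (of_real x) =
           (\<Sum>m = 0..k div 2.
              Lambda1 k m \<mu> / (of_real x powi (- int m))
              * gegenbauer (k - 2 * m) (1/2 - 2 * of_nat k + 2 * of_nat m - \<mu>) (of_real x)
              * gegenbauer m (of_nat k - of_nat m + \<mu> + 1/2) (of_real ((1 + x\<^sup>2) / (2 * x))))
       \<and> of_real x ^ l * gegenbauer l (\<mu> + of_nat l + 1/2) (of_real ((1 + x\<^sup>2) / (2 * x))) =
           (\<Sum>n = 0..2 * l.
              Lambda2 l n \<mu>
              * gegenbauer n (1/2 + 2 * of_nat l + \<mu> - of_nat n) (of_real x)
              * gegenbauer (2 * l - n) (\<mu> + of_nat n + 1/2) (of_real x))"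
proof
  let ?X = "of_real x :: complex"
  have X: "?X \<noteq> 0"
    using \<open>x \<noteq> 0\<close> by simp
  have Y: "of_real ((1 + x\<^sup>2) / (2 * x)) = (1 + ?X\<^sup>2) / (2 * ?X)"
    by simp
  show "gegenbauer k (\<mu> + 1/2) ?X =
           (\<Sum>m = 0..k div 2.
              Lambda1 k m \<mu> / (?X powi (- int m))
              * gegenbauer (k - 2 * m) (1/2 - 2 * of_nat k + 2 * of_nat m - \<mu>) ?X
              * gegenbauer m (of_nat k - of_nat m + \<mu> + 1/2) (of_real ((1 + x\<^sup>2) / (2 * x))))"
    unfolding Y by (rule gegenbauer_expansion_mixed_arguments[OF assms(1) X])
  show "?X ^ l * gegenbauer l (\<mu> + of_nat l + 1/2) (of_real ((1 + x\<^sup>2) / (2 * x))) =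
           (\<Sum>n = 0..2 * l.
              Lambda2 l n \<mu>
              * gegenbauer n (1/2 + 2 * of_nat l + \<mu> - of_nat n) ?X
              * gegenbauer (2 * l - n) (\<mu> + of_nat n + 1/2) ?X)"
    unfolding Y by (rule gegenbauer_joukowski_expansion_products[OF assms(2) X])
qed

end
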